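(* Let $\mapsto_\rho$ be a rule on $\Lambda_{!\mathcal{O}}$ and assume $\to \,=\, \to_{!\beta}\cup\to_\rho$ has a good least-level. Then for all bang terms $T,S$: $T\to_{!\beta}^* S$ implies $T\to_{\ell\ell,!\beta}^*\cdot\to_{\neg\ell\ell,!\beta}^* S$.
   Context: Bang terms $T ::= x\mid\lambda x.T\mid TS\mid !T\mid\mathbf{o}(T_1,\dots,T_k)$ over a set $\mathcal{O}$ of operators with arities (set $\Lambda_{!\mathcal{O}}$); contexts $C ::= [\cdot]\mid\lambda x.C\mid TC\mid CT\mid !C\mid\mathbf{o}(\dots,C,\dots)$. For a rule $\mapsto_\gamma$ (binary relation on terms) $\to_\gamma$ is its contextual closure and its redexes are its left-hand sides. $(\lambda x.T)\,!S\mapsto_{!\beta}T[S/x]$. Level: $\mathrm{lev}([\cdot])=0$, $\mathrm{lev}(\lambda x.C)=\mathrm{lev}(CT)=\mathrm{lev}(TC)=\mathrm{lev}(C)$, $\mathrm{lev}(!C)=\mathrm{lev}(\mathbf{o}(\dots,C,\dots))=\mathrm{lev}(C)+1$. With $\mathcal{R}$ the set of $!\beta$-redexes and $\rho$-redexes, $\mathrm{ll}(T)=\inf\{\mathrm{lev}(C)\mid T=C[R],R\in\mathcal{R}\}\in\mathbb{N}\cup\{\infty\}$. A $\gamma$-step $C[R]\to_\gamma C[R']$ is least-level ($\to_{\ell\ell,\gamma}$) if $\mathrm{lev}(C)=\mathrm{ll}(C[R])$, internal ($\to_{\neg\ell\ell,\gamma}$) if $\mathrm{lev}(C)>\mathrm{ll}(C[R])$;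 $\to_{\ell\ell}$, $\to_{\neg\ell\ell}$ are the unions over the rules. $\to$ has a good least-level if $T\to S$ implies $\mathrm{ll}(T)\le\mathrm{ll}(S)$ and $T\to_{\neg\ell\ell}S$ implies $\mathrm{ll}(T)=\mathrm{ll}(S)$. $\cdot$ is relational composition. *)

theory Defs
  imports Main "HOL-Library.Extended_Nat"
begin

text \<open>
  Bang terms are taken modulo renaming of bound variables.  They are represented by de Bruijn terms
  whose free variables are the natural numbers, regarded as names; \<open>Abs\<close> is only the raw
  constructor, and the named binder of the calculus is \<open>lam\<close> below.  Every raw abstraction
  is a named one (lemma \<open>Abs_is_lam\<close>), and \<open>lam\<close> identifies exactly the
  alpha-equivalent terms (lemma \<open>lam_eq_iff\<close>).
  An indexed context closure would be adequate only for rules invariant under renaming.  Here a rule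
  is an arbitrary relation on terms with named variables, and contexts bind (and capture) named
  variables.
\<close>

datatype 'o trm =
    Var nat
  | Abs "'o trm"
  | App "'o trm" "'o trm"
  | Bang "'o trm"
  | Op 'o "'o trm list"

primrec fv :: "'o trm \<Rightarrow> nat set" where
  "fv (Var x) = {x}"
| "fv (Abs T) = {x. Suc x \<in> fv T}"
| "fv (App T S) = fv T \<union> fv S"
| "fv (Bang T) = fv T"
| "fv (Op f Ts) = \<Union> (set (map fv Ts))"

fun ren :: "(nat \<Rightarrow> nat) \<Rightarrow> 'o trm \<Rightarrow> 'o trm" where
  "ren r (Var x) = Var (r x)"
| "ren r (Abs T) = Abs (ren (case_nat 0 (\<lambda>x. Suc (r x))) T)"
| "ren r (App T S) = App (ren r T) (ren r S)"
| "ren r (Bang T) = Bang (ren r T)"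
| "ren r (Op f Ts) = Op f (map (ren r) Ts)"

fun msubst :: "(nat \<Rightarrow> 'o trm) \<Rightarrow> 'o trm \<Rightarrow> 'o trm" where
  "msubst s (Var x) = s x"
| "msubst s (Abs T) = Abs (msubst (case_nat (Var 0) (\<lambda>x. ren Suc (s x))) T)"
| "msubst s (App T S) = App (msubst s T) (msubst s S)"
| "msubst s (Bang T) = Bang (msubst s T)"
| "msubst s (Op f Ts) = Op f (map (msubst s) Ts)"

text \<open>The term $\lambda x.T$: the name \<open>x\<close> becomes the bound index \<open>0\<close>.\<close>

definition lam :: "nat \<Rightarrow> 'o trm \<Rightarrow> 'o trm" where
  "lam x T = Abs (ren (\<lambda>y. if y = x then 0 else Suc y) T)"

text \<open>Capture-avoiding substitution $T[S/x]$ is written \<open>subst T S x\<close>.\<close>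

definition subst :: "'o trm \<Rightarrow> 'o trm \<Rightarrow> nat \<Rightarrow> 'o trm" where
  "subst T S x = msubst (Var(x := S)) T"

text \<open>
  A signature is a partial map from operators to arities; its domain is the set of operators.
\<close>

type_synonym 'o sig = "'o \<rightharpoonup> nat"

inductive_set terms :: "'o sig \<Rightarrow> 'o trm set" for \<Sigma> :: "'o sig" where
  var: "Var x \<in> terms \<Sigma>"
| lam: "T \<in> terms \<Sigma> \<Longrightarrow> lam x T \<in> terms \<Sigma>"
| app: "T \<in> terms \<Sigma> \<Longrightarrow> S \<in> terms \<Sigma> \<Longrightarrow> App T S \<in> terms \<Sigma>"
| bang: "T \<in> terms \<Sigma> \<Longrightarrow> Bang T \<in> terms \<Sigma>"
| op: "\<Sigma> f = Some (length Ts) \<Longrightarrow> \<forall>T \<in> set Ts. T \<in> terms \<Sigma> \<Longrightarrow> Op f Ts \<in> terms \<Sigma>"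

datatype 'o ctx =
    Hole
  | CLam nat "'o ctx"
  | CAppR "'o trm" "'o ctx"
  | CAppL "'o ctx" "'o trm"
  | CBang "'o ctx"
  | COp 'o "'o trm list" "'o ctx" "'o trm list"

inductive_set ctxs :: "'o sig \<Rightarrow> 'o ctx set" for \<Sigma> :: "'o sig" where
  hole: "Hole \<in> ctxs \<Sigma>"
| lam: "C \<in> ctxs \<Sigma> \<Longrightarrow> CLam x C \<in> ctxs \<Sigma>"
| appR: "T \<in> terms \<Sigma> \<Longrightarrow> C \<in> ctxs \<Sigma> \<Longrightarrow> CAppR T C \<in> ctxs \<Sigma>"
| appL: "C \<in> ctxs \<Sigma> \<Longrightarrow> T \<in> terms \<Sigma> \<Longrightarrow> CAppL C T \<in> ctxs \<Sigma>"
| bang: "C \<in> ctxs \<Sigma> \<Longrightarrow> CBang C \<in> ctxs \<Sigma>"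
| op: "\<Sigma> f = Some (length Ts + 1 + length Us) \<Longrightarrow> C \<in> ctxs \<Sigma> \<Longrightarrow>
    set Ts \<subseteq> terms \<Sigma> \<Longrightarrow> set Us \<subseteq> terms \<Sigma> \<Longrightarrow> COp f Ts C Us \<in> ctxs \<Sigma>"

primrec plug :: "'o ctx \<Rightarrow> 'o trm \<Rightarrow> 'o trm" where
  "plug Hole R = R"
| "plug (CLam x C) R = lam x (plug C R)"
| "plug (CAppR T C) R = App T (plug C R)"
| "plug (CAppL C T) R = App (plug C R) T"
| "plug (CBang C) R = Bang (plug C R)"
| "plug (COp f Ts C Us) R = Op f (Ts @ plug C R # Us)"

primrec lev :: "'o ctx \<Rightarrow> nat" where
  "lev Hole = 0"
| "lev (CLam x C) = lev C"
| "lev (CAppR T C) = lev C"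
| "lev (CAppL C T) = lev C"
| "lev (CBang C) = lev C + 1"
| "lev (COp f Ts C Us) = lev C + 1"

definition is_rule :: "'o sig \<Rightarrow> 'o trm rel \<Rightarrow> bool" where
  "is_rule \<Sigma> \<gamma> \<longleftrightarrow> \<gamma> \<subseteq> terms \<Sigma> \<times> terms \<Sigma>"

definition bang_beta :: "'o sig \<Rightarrow> 'o trm rel" where
  "bang_beta \<Sigma> = {(App (lam x T) (Bang S), subst T S x) | x T S. T \<in> terms \<Sigma> \<and> S \<in> terms \<Sigma>}"

definition step :: "'o sig \<Rightarrow> 'o trm rel \<Rightarrow> 'o trm rel" where
  "step \<Sigma> \<gamma> = {(plug C R, plug C R') | C R R'. C \<in> ctxs \<Sigma> \<and> (R, R') \<in> \<gamma>}"

text \<open>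
  From here on, \<open>\<rho>\<close> is the rule added to \<open>bang_beta\<close>; the least level is
  always computed with respect to the redexes of both rules.
\<close>

definition redexes :: "'o sig \<Rightarrow> 'o trm rel \<Rightarrow> 'o trm set" where
  "redexes \<Sigma> \<rho> = Domain (bang_beta \<Sigma>) \<union> Domain \<rho>"

definition ll :: "'o sig \<Rightarrow> 'o trm rel \<Rightarrow> 'o trm \<Rightarrow> enat" where
  "ll \<Sigma> \<rho> T = Inf {enat (lev C) | C R. C \<in> ctxs \<Sigma> \<and> T = plug C R \<and> R \<in> redexes \<Sigma> \<rho>}"

definition ll_step :: "'o sig \<Rightarrow> 'o trm rel \<Rightarrow> 'o trm rel \<Rightarrow> 'o trm rel" where
  "ll_step \<Sigma> \<rho> \<gamma> = {(plug C R, plug C R') | C R R'.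
     C \<in> ctxs \<Sigma> \<and> (R, R') \<in> \<gamma> \<and> enat (lev C) = ll \<Sigma> \<rho> (plug C R)}"

definition internal_step :: "'o sig \<Rightarrow> 'o trm rel \<Rightarrow> 'o trm rel \<Rightarrow> 'o trm rel" where
  "internal_step \<Sigma> \<rho> \<gamma> = {(plug C R, plug C R') | C R R'.
     C \<in> ctxs \<Sigma> \<and> (R, R') \<in> \<gamma> \<and> enat (lev C) > ll \<Sigma> \<rho> (plug C R)}"

definition good_least_level :: "'o sig \<Rightarrow> 'o trm rel \<Rightarrow> bool" where
  "good_least_level \<Sigma> \<rho> \<longleftrightarrow>
     (\<forall>(T, S) \<in> step \<Sigma> (bang_beta \<Sigma>) \<union> step \<Sigma> \<rho>. ll \<Sigma> \<rho> T \<le> ll \<Sigma> \<rho> S) \<and>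
     (\<forall>(T, S) \<in> internal_step \<Sigma> \<rho> (bang_beta \<Sigma>) \<union> internal_step \<Sigma> \<rho> \<rho>. ll \<Sigma> \<rho> T = ll \<Sigma> \<rho> S)"


section \<open>Adequacy of the representation\<close>

lemma ren_cong: "(\<And>x. x \<in> fv T \<Longrightarrow> r x = r' x) \<Longrightarrow> ren r T = ren r' T"
proof (induction T arbitrary: r r')
  case (Abs T)
  have "ren (case_nat 0 (\<lambda>x. Suc (r x))) T = ren (case_nat 0 (\<lambda>x. Suc (r' x))) T"
    by (rule Abs.IH) (auto split: nat.split simp: Abs.prems)
  then show ?case by simp
next
  case (App T U)
  have "ren r T = ren r' T" by (rule App.IH) (simp add: App.prems)
  moreover have "ren r U = ren r' U" by (rule App.IH) (simp add: App.prems)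
  ultimately show ?case by simp
next
  case (Op f Ts)
  have "ren r T = ren r' T" if "T \<in> set Ts" for T
    by (rule Op.IH[OF that]) (use that Op.prems in auto)
  then show ?case by simp
next
  case (Bang T)
  have "ren r T = ren r' T" by (rule Bang.IH) (simp add: Bang.prems)
  then show ?case by simp
qed simp

lemma ren_id [simp]: "ren (\<lambda>x. x) T = T"
proof (induction T)
  case (Abs T)
  have "case_nat 0 Suc = (\<lambda>x. x)" by (auto split: nat.split)
  with Abs show ?case by simp
qed (auto simp: map_idI)

lemma ren_ren: "ren r (ren q T) = ren (\<lambda>x. r (q x)) T"
proof (induction T arbitrary: r q)
  case (Abs T)
  have "(\<lambda>x. case_nat 0 (\<lambda>x. Suc (r x)) (case_nat 0 (\<lambda>x. Suc (q x)) x))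
      = case_nat 0 (\<lambda>x. Suc (r (q x)))" by (auto split: nat.split)
  with Abs show ?case by simp
qed auto

lemma fv_ren: "fv (ren r T) = r ` fv T"
proof (induction T arbitrary: r)
  case (Abs T)
  have "Suc x = case_nat 0 (\<lambda>x. Suc (r x)) y \<longleftrightarrow> (\<exists>z. y = Suc z \<and> x = r z)" for x y
    by (cases y) auto
  then show ?case
    by (simp add: Abs.IH image_def set_eq_iff) blast
qed auto

lemma finite_fv: "finite (fv T)"
proof (induction T)
  case (Abs T)
  have "{x. Suc x \<in> fv T} = Suc -` fv T" by auto
  with Abs show ?case by (simp add: finite_vimageI)
qed auto

lemma fv_lam: "fv (lam x T) = fv T - {x}"
  by (auto simp: lam_def fv_ren image_iff split: if_splits)

lemma msubst_ren: "msubst s (ren r T) = msubst (\<lambda>x. s (r x)) T"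
proof (induction T arbitrary: s r)
  case (Abs T)
  have "(\<lambda>x. case_nat (Var 0) (\<lambda>x. ren Suc (s x)) (case_nat 0 (\<lambda>x. Suc (r x)) x))
      = case_nat (Var 0) (\<lambda>x. ren Suc (s (r x)))" by (auto split: nat.split)
  with Abs show ?case by simp
qed auto

lemma ren_msubst: "ren r (msubst s T) = msubst (\<lambda>x. ren r (s x)) T"
proof (induction T arbitrary: s r)
  case (Abs T)
  have "(\<lambda>x. ren (case_nat 0 (\<lambda>x. Suc (r x))) (case_nat (Var 0) (\<lambda>x. ren Suc (s x)) x))
      = case_nat (Var 0) (\<lambda>x. ren Suc (ren r (s x)))" by (auto split: nat.split simp: ren_ren)
  with Abs show ?case by simp
qed auto

lemma msubst_Var: "msubst (\<lambda>x. Var (r x)) T = ren r T" for T :: "'o trm"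
proof (induction T arbitrary: r)
  case (Abs T)
  have "case_nat (Var 0) (\<lambda>x. ren Suc (Var (r x)))
      = (\<lambda>x. Var (case_nat 0 (\<lambda>x. Suc (r x)) x) :: 'o trm)"
    by (auto split: nat.split)
  then show ?case by (simp only: msubst.simps ren.simps(2) Abs.IH)
qed auto

lemma msubst_cong: "(\<And>x. x \<in> fv T \<Longrightarrow> s x = s' x) \<Longrightarrow> msubst s T = msubst s' T"
proof (induction T arbitrary: s s')
  case (Abs T)
  have "msubst (case_nat (Var 0) (\<lambda>x. ren Suc (s x))) T = msubst (case_nat (Var 0) (\<lambda>x. ren Suc (s' x))) T"
    by (rule Abs.IH) (auto split: nat.split simp: Abs.prems)
  then show ?case by simp
next
  case (App T U)
  have "msubst s T = msubst s' T" by (rule App.IH) (simp add: App.prems)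
  moreover have "msubst s U = msubst s' U" by (rule App.IH) (simp add: App.prems)
  ultimately show ?case by simp
next
  case (Op f Ts)
  have "msubst s T = msubst s' T" if "T \<in> set Ts" for T
    by (rule Op.IH[OF that]) (use that Op.prems in auto)
  then show ?case by simp
next
  case (Bang T)
  have "msubst s T = msubst s' T" by (rule Bang.IH) (simp add: Bang.prems)
  then show ?case by simp
qed simp

lemma subst_Var: "subst T (Var y) x = ren (id(x := y)) T" for T :: "'o trm"
proof -
  have "Var(x := Var y) = (\<lambda>z. Var ((id(x := y)) z) :: 'o trm)" by auto
  then show ?thesis unfolding subst_def by (simp only: msubst_Var)
qed

lemma Abs_is_lam: "\<exists>x T. x \<notin> fv (Abs B) \<and> Abs B = lam x T"
proof -
  obtain x where x: "x \<notin> fv (Abs B)"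
    using finite_fv ex_new_if_finite infinite_UNIV_nat by metis
  have "ren (\<lambda>y. if case_nat x id y = x then 0 else Suc (case_nat x id y)) B = ren (\<lambda>y. y) B"
    using x by (intro ren_cong) (auto split: nat.split)
  then have "Abs B = lam x (ren (case_nat x id) B)"
    by (simp add: lam_def ren_ren)
  with x show ?thesis by blast
qed

lemma lam_inject: "lam x T = lam x U \<longleftrightarrow> T = U"
proof
  let ?r = "\<lambda>y. if y = x then 0 else Suc y"
  assume "lam x T = lam x U"
  then have "ren (case_nat x id) (ren ?r T) = ren (case_nat x id) (ren ?r U)"
    by (simp add: lam_def)
  moreover have "(\<lambda>y. case_nat x id (?r y)) = (\<lambda>y. y)" by auto
  ultimately show "T = U" by (simp only: ren_ren ren_id)
qed simp

lemma lam_rename: "y \<notin> fv T - {x} \<Longrightarrow> lam y (subst T (Var y) x) = lam x T"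
  by (auto simp: lam_def subst_Var ren_ren intro!: ren_cong)

lemma lam_eq_iff:
  "lam x T = lam y U \<longleftrightarrow> y \<notin> fv T - {x} \<and> U = subst T (Var y) x"
proof
  assume eq: "lam x T = lam y U"
  then have "fv T - {x} = fv U - {y}" using fv_lam[of x T] fv_lam[of y U] by simp
  then have y: "y \<notin> fv T - {x}" by blast
  have "lam y U = lam y (subst T (Var y) x)"
    using lam_rename[OF y] eq by (rule trans[OF _ _, symmetric])
  then have "U = subst T (Var y) x" by (rule iffD1[OF lam_inject])
  with y show "y \<notin> fv T - {x} \<and> U = subst T (Var y) x" ..
next
  assume y: "y \<notin> fv T - {x} \<and> U = subst T (Var y) x"
  then show "lam x T = lam y U" using lam_rename[of y T x] by (elim conjE) (simp only: simp_thms)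
qed

lemma subst_simps:
  "subst (Var y) S x = (if y = x then S else Var y)"
  "y \<noteq> x \<Longrightarrow> y \<notin> fv S \<Longrightarrow> subst (lam y T) S x = lam y (subst T S x)"
  "subst (App T U) S x = App (subst T S x) (subst U S x)"
  "subst (Bang T) S x = Bang (subst T S x)"
  "subst (Op f Ts) S x = Op f (map (\<lambda>T. subst T S x) Ts)"
proof -
  assume "y \<noteq> x" and y: "y \<notin> fv S"
  have "ren Suc S = ren (\<lambda>z. if z = y then 0 else Suc z) S"
    using y by (auto intro: ren_cong)
  then show "subst (lam y T) S x = lam y (subst T S x)"
    using \<open>y \<noteq> x\<close>
    by (auto simp: lam_def subst_def msubst_ren ren_msubst intro!: msubst_cong)
qed (simp_all add: subst_def)

end

theory Submission
  imports Defs
begin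

text \<open>
  Let \<open>par d\<close> be parallel reduction, contracting any set of redexes of level at least \<open>d\<close>.
  Merge: contracting redexes of level above \<open>d\<close> creates nothing at level \<open>d\<close> or below, so a step of
  level at most \<open>d\<close> that follows \<open>par (d + 1)\<close> can be absorbed into it.
  Split: \<open>par d\<close> decomposes into steps of level exactly \<open>d\<close> followed by \<open>par (d + 1)\<close>.  Splitting
  repeatedly, the level-\<open>d\<close> steps are least-level as long as the least level of the current term
  is \<open>d\<close>; the process ends because the result of a contraction at level \<open>d\<close> still occupies a
  position of level \<open>d\<close> in the fixed target term.
  Merge and split together let a parallel internal step be postponed after a least-level one.
\<close>

section \<open>Substitution\<close>

abbreviation lift_ren :: "(nat \<Rightarrow> nat) \<Rightarrow> nat \<Rightarrow> nat" where
  "lift_ren r \<equiv> case_nat 0 (\<lambda>x. Suc (r x))"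

abbreviation lift_subst :: "(nat \<Rightarrow> 'o trm) \<Rightarrow> nat \<Rightarrow> 'o trm" where
  "lift_subst s \<equiv> case_nat (Var 0) (\<lambda>x. ren Suc (s x))"

text \<open>The contractum of the raw redex \<open>App (Abs B) (Bang S)\<close>: index 0 becomes
  \<open>S\<close> and every other index drops by one. Contraction thus needs no name for the
  binder.\<close>

definition inst :: "'o trm \<Rightarrow> 'o trm \<Rightarrow> 'o trm" where
  "inst B S = msubst (case_nat S Var) B"

lemma msubst_msubst: "msubst s (msubst t T) = msubst (\<lambda>x. msubst s (t x)) T"
proof (induction T arbitrary: s t)
  case (Abs T)
  have "(\<lambda>x. msubst (lift_subst s) (lift_subst t x)) = lift_subst (\<lambda>x. msubst s (t x))"
    by (auto split: nat.split simp: msubst_ren ren_msubst)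
  with Abs show ?case by simp
qed auto

lemma msubst_Var_id: "msubst Var T = T"
  using msubst_Var[of "\<lambda>x. x" T] by simp

lemma ren_inst: "ren r (inst B S) = inst (ren (lift_ren r) B) (ren r S)"
  unfolding inst_def msubst_ren ren_msubst
  by (rule msubst_cong) (auto split: nat.split)

lemma msubst_inst: "msubst s (inst B S) = inst (msubst (lift_subst s) B) (msubst s S)"
  unfolding inst_def msubst_msubst
  by (rule msubst_cong) (auto split: nat.split simp: msubst_ren msubst_Var_id)

lemma subst_eq_inst: "subst T S x = inst (ren (\<lambda>y. if y = x then 0 else Suc y) T) S"
  unfolding subst_def inst_def msubst_ren by (rule msubst_cong) auto

lemma fv_msubst: "fv (msubst s T) = (\<Union>x\<in>fv T. fv (s x))"
proof (induction T arbitrary: s)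
  case (Abs T)
  have "Suc x \<in> fv (lift_subst s y) \<longleftrightarrow> (\<exists>z. y = Suc z \<and> x \<in> fv (s z))" for x y
    by (cases y) (auto simp: fv_ren)
  then show ?case by (simp add: Abs set_eq_iff) blast
qed auto

lemma fv_inst: "fv (inst B S) \<subseteq> fv (Abs B) \<union> fv S"
  by (auto simp: inst_def fv_msubst split: nat.splits)

lemma Abs_as_lam:
  assumes "x \<notin> fv (Abs B)"
  shows "Abs B = lam x (ren (case_nat x id) B)"
proof -
  have "ren (\<lambda>y. if case_nat x id y = x then 0 else Suc (case_nat x id y)) B = ren (\<lambda>y. y) B"
    using assms by (intro ren_cong) (auto split: nat.split)
  then show ?thesis by (simp add: lam_def ren_ren)
qed

lemma ex_fresh: "\<exists>x. x \<notin> fv T"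
  using finite_fv ex_new_if_finite infinite_UNIV_nat by metis

section \<open>Well-formed terms\<close>

text \<open>Membership in \<open>terms\<close> is generated by \<open>lam\<close>, which renames the
  body; this version follows the raw constructors and so suits structural induction.\<close>

primrec wf_trm :: "'o sig \<Rightarrow> 'o trm \<Rightarrow> bool" where
  "wf_trm \<Sigma> (Var x) \<longleftrightarrow> True"
| "wf_trm \<Sigma> (Abs T) \<longleftrightarrow> wf_trm \<Sigma> T"
| "wf_trm \<Sigma> (App T S) \<longleftrightarrow> wf_trm \<Sigma> T \<and> wf_trm \<Sigma> S"
| "wf_trm \<Sigma> (Bang T) \<longleftrightarrow> wf_trm \<Sigma> T"
| "wf_trm \<Sigma> (Op f Ts) \<longleftrightarrow> \<Sigma> f = Some (length Ts) \<and> list_all (wf_trm \<Sigma>) Ts"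

lemma wf_ren [simp]: "wf_trm \<Sigma> (ren r T) = wf_trm \<Sigma> T"
  by (induction T arbitrary: r) (auto simp: list_all_iff)

lemma wf_msubst: "wf_trm \<Sigma> T \<Longrightarrow> (\<And>x. wf_trm \<Sigma> (s x)) \<Longrightarrow> wf_trm \<Sigma> (msubst s T)"
  by (induction T arbitrary: s) (auto simp: list_all_iff split: nat.split)

text \<open>Writing \<open>Abs T\<close> as a \<open>lam\<close> puts a renamed copy of
  \<open>T\<close> under the binder, so the induction has to cover all renamings at once.\<close>

lemma wf_ren_terms: "wf_trm \<Sigma> T \<Longrightarrow> ren r T \<in> terms \<Sigma>"
proof (induction T arbitrary: r)
  case (Abs T)
  obtain x where "x \<notin> fv (ren r (Abs T))" using ex_fresh by blast
  then have "ren r (Abs T) = lam x (ren (case_nat x id) (ren (lift_ren r) T))"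
    unfolding ren.simps by (rule Abs_as_lam)
  with Abs show ?case by (auto simp: ren_ren intro: terms.lam)
qed (auto simp: list_all_iff intro!: terms.intros)

lemma terms_iff_wf: "T \<in> terms \<Sigma> \<longleftrightarrow> wf_trm \<Sigma> T"
proof
  show "wf_trm \<Sigma> T" if "T \<in> terms \<Sigma>"
    using that by induction (auto simp: lam_def list_all_iff)
  show "T \<in> terms \<Sigma>" if "wf_trm \<Sigma> T"
    using wf_ren_terms[OF that, of "\<lambda>x. x"] by simp
qed

section \<open>Steps of a given level\<close>

text \<open>Replaces contexts that bind names by a closure under raw constructors which records the
  level; the signature is left to \<open>wf_trm\<close>.\<close>

inductive beta_at :: "nat \<Rightarrow> 'o trm \<Rightarrow> 'o trm \<Rightarrow> bool" where
  beta: "beta_at 0 (App (Abs B) (Bang S)) (inst B S)"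
| Abs: "beta_at n T T' \<Longrightarrow> beta_at n (Abs T) (Abs T')"
| AppL: "beta_at n T T' \<Longrightarrow> beta_at n (App T S) (App T' S)"
| AppR: "beta_at n S S' \<Longrightarrow> beta_at n (App T S) (App T S')"
| Bang: "beta_at n T T' \<Longrightarrow> beta_at (Suc n) (Bang T) (Bang T')"
| Op: "beta_at n T T' \<Longrightarrow> beta_at (Suc n) (Op f (Ts @ T # Us)) (Op f (Ts @ T' # Us))"

lemma beta_at_ren: "beta_at n T S \<Longrightarrow> beta_at n (ren r T) (ren r S)"
  by (induction arbitrary: r rule: beta_at.induct) (auto simp: ren_inst intro: beta_at.intros)

text \<open>A name fresh for the source stays fresh for the target, so one \<open>CLam x\<close> can
  enclose both sides of a step under a binder.\<close>

lemma beta_at_fv: "beta_at n T S \<Longrightarrow> fv S \<subseteq> fv T"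
proof (induction rule: beta_at.induct)
  case (beta B S)
  then show ?case using fv_inst[of B S] by simp
qed auto

lemma wf_beta_at: "beta_at n T S \<Longrightarrow> wf_trm \<Sigma> T \<Longrightarrow> wf_trm \<Sigma> S"
  by (induction rule: beta_at.induct) (auto simp: inst_def intro!: wf_msubst split: nat.split)

definition ctx_step :: "'o sig \<Rightarrow> nat \<Rightarrow> 'o trm \<Rightarrow> 'o trm \<Rightarrow> bool" where
  "ctx_step \<Sigma> n T S \<longleftrightarrow> (\<exists>C R R'. C \<in> ctxs \<Sigma> \<and> (R, R') \<in> bang_beta \<Sigma> \<and>
     lev C = n \<and> T = plug C R \<and> S = plug C R')"

lemma ctx_stepI:
  "C \<in> ctxs \<Sigma> \<Longrightarrow> (R, R') \<in> bang_beta \<Sigma> \<Longrightarrow> ctx_step \<Sigma> (lev C) (plug C R) (plug C R')"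
  unfolding ctx_step_def by blast

lemma ctx_stepE:
  assumes "ctx_step \<Sigma> n T S"
  obtains C R R' where "C \<in> ctxs \<Sigma>" "(R, R') \<in> bang_beta \<Sigma>" "lev C = n" "T = plug C R" "S = plug C R'"
  using assms unfolding ctx_step_def by blast

lemma wf_plug: "C \<in> ctxs \<Sigma> \<Longrightarrow> wf_trm \<Sigma> R \<Longrightarrow> wf_trm \<Sigma> (plug C R)"
  by (induction rule: ctxs.induct) (auto simp: lam_def list_all_iff subset_iff terms_iff_wf)

lemma plug_beta_at: "beta_at 0 R R' \<Longrightarrow> beta_at (lev C) (plug C R) (plug C R')"
  by (induction C) (auto simp: lam_def intro: beta_at.intros beta_at_ren)

text \<open>Generalised over \<open>r\<close> because passing to a named binder renames the body;
  the identity renaming gives the statement that is wanted.\<close>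

lemma beta_at_ren_ctx_step: "beta_at n T S \<Longrightarrow> wf_trm \<Sigma> T \<Longrightarrow> ctx_step \<Sigma> n (ren r T) (ren r S)"
proof (induction arbitrary: r rule: beta_at.induct)
  case (beta B S)
  let ?B = "ren (lift_ren r) B"
  obtain x where x: "x \<notin> fv (Abs ?B)" using ex_fresh by blast
  have *: "Abs ?B = lam x (ren (case_nat x id) ?B)" using x by (rule Abs_as_lam)
  then have "ren (\<lambda>y. if y = x then 0 else Suc y) (ren (case_nat x id) ?B) = ?B"
    by (simp add: lam_def)
  then have "inst ?B (ren r S) = subst (ren (case_nat x id) ?B) (ren r S) x"
    by (simp only: subst_eq_inst)
  with * beta.prems have "(App (Abs ?B) (Bang (ren r S)), inst ?B (ren r S)) \<in> bang_beta \<Sigma>"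
    unfolding bang_beta_def mem_Collect_eq
    by (intro exI[of _ x] exI[of _ "ren (case_nat x id) ?B"] exI[of _ "ren r S"])
      (simp add: terms_iff_wf)
  from ctx_stepI[OF ctxs.hole this] show ?case by (simp add: ren_inst)
next
  case (Abs n T T')
  obtain x where x: "x \<notin> fv (ren r (Abs T))" using ex_fresh by blast
  then have x': "x \<notin> fv (ren r (Abs T'))"
    using beta_at_fv[OF beta_at_ren[OF beta_at.Abs[OF Abs.hyps]]] by blast
  \<comment> \<open>Lifting \<open>r\<close> under the binder and then giving index 0 the name
    \<open>x\<close> is a single renaming, to which the induction hypothesis applies.\<close>
  have "ctx_step \<Sigma> n (ren (\<lambda>y. case_nat x id (lift_ren r y)) T)
      (ren (\<lambda>y. case_nat x id (lift_ren r y)) T')"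
    using Abs by simp
  then obtain C R R' where C: "C \<in> ctxs \<Sigma>" "(R, R') \<in> bang_beta \<Sigma>" "lev C = n"
      "ren (case_nat x id) (ren (lift_ren r) T) = plug C R"
      "ren (case_nat x id) (ren (lift_ren r) T') = plug C R'"
    by (auto simp: ren_ren elim: ctx_stepE)
  from ctx_stepI[OF ctxs.lam[OF C(1), of x] C(2)] C(3)
  have "ctx_step \<Sigma> n (lam x (plug C R)) (lam x (plug C R'))" by simp
  then show ?case
    using Abs_as_lam[OF x[unfolded ren.simps]] Abs_as_lam[OF x'[unfolded ren.simps]]
    by (simp flip: C(4,5))
next
  case (AppL n T T' S)
  then have "ctx_step \<Sigma> n (ren r T) (ren r T')" by simp
  then obtain C R R' where C: "C \<in> ctxs \<Sigma>" "(R, R') \<in> bang_beta \<Sigma>" "lev C = n"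
      "ren r T = plug C R" "ren r T' = plug C R'" by (rule ctx_stepE)
  have "ren r S \<in> terms \<Sigma>" using AppL.prems by (simp add: terms_iff_wf)
  from ctx_stepI[OF ctxs.appL[OF C(1) this] C(2)] C show ?case by simp
next
  case (AppR n S S' T)
  then have "ctx_step \<Sigma> n (ren r S) (ren r S')" by simp
  then obtain C R R' where C: "C \<in> ctxs \<Sigma>" "(R, R') \<in> bang_beta \<Sigma>" "lev C = n"
      "ren r S = plug C R" "ren r S' = plug C R'" by (rule ctx_stepE)
  have "ren r T \<in> terms \<Sigma>" using AppR.prems by (simp add: terms_iff_wf)
  from ctx_stepI[OF ctxs.appR[OF this C(1)] C(2)] C show ?case by simp
next
  case (Bang n T T')
  then have "ctx_step \<Sigma> n (ren r T) (ren r T')" by simp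
  then obtain C R R' where C: "C \<in> ctxs \<Sigma>" "(R, R') \<in> bang_beta \<Sigma>" "lev C = n"
      "ren r T = plug C R" "ren r T' = plug C R'" by (rule ctx_stepE)
  from ctx_stepI[OF ctxs.bang[OF C(1)] C(2)] C show ?case by simp
next
  case (Op n T T' f Ts Us)
  then have "ctx_step \<Sigma> n (ren r T) (ren r T')" by simp
  then obtain C R R' where C: "C \<in> ctxs \<Sigma>" "(R, R') \<in> bang_beta \<Sigma>" "lev C = n"
      "ren r T = plug C R" "ren r T' = plug C R'" by (rule ctx_stepE)
  have "COp f (map (ren r) Ts) C (map (ren r) Us) \<in> ctxs \<Sigma>"
    using Op.prems C(1) by (intro ctxs.op) (auto simp: terms_iff_wf list_all_iff)
  from ctx_stepI[OF this C(2)] C show ?case by simp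
qed

lemma ctx_step_iff: "ctx_step \<Sigma> n T S \<longleftrightarrow> wf_trm \<Sigma> T \<and> beta_at n T S"
proof
  assume "ctx_step \<Sigma> n T S"
  then obtain C R R' where C: "C \<in> ctxs \<Sigma>" "(R, R') \<in> bang_beta \<Sigma>" "lev C = n"
      "T = plug C R" "S = plug C R'" by (rule ctx_stepE)
  from C(2) have "wf_trm \<Sigma> R" "beta_at 0 R R'"
    by (auto simp: bang_beta_def lam_def subst_eq_inst terms_iff_wf intro: beta_at.beta)
  with C wf_plug plug_beta_at show "wf_trm \<Sigma> T \<and> beta_at n T S" by blast
next
  assume "wf_trm \<Sigma> T \<and> beta_at n T S"
  then show "ctx_step \<Sigma> n T S"
    using beta_at_ren_ctx_step[of n T S \<Sigma> "\<lambda>x. x"] by simp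
qed

lemma step_iff: "(T, S) \<in> step \<Sigma> (bang_beta \<Sigma>) \<longleftrightarrow> wf_trm \<Sigma> T \<and> (\<exists>n. beta_at n T S)"
proof -
  have "(T, S) \<in> step \<Sigma> (bang_beta \<Sigma>) \<longleftrightarrow> (\<exists>n. ctx_step \<Sigma> n T S)"
    unfolding step_def ctx_step_def by blast
  then show ?thesis by (auto simp: ctx_step_iff)
qed

lemma ll_step_iff:
  "(T, S) \<in> ll_step \<Sigma> \<rho> (bang_beta \<Sigma>) \<longleftrightarrow> wf_trm \<Sigma> T \<and> (\<exists>n. beta_at n T S \<and> enat n = ll \<Sigma> \<rho> T)"
proof -
  have "(T, S) \<in> ll_step \<Sigma> \<rho> (bang_beta \<Sigma>) \<longleftrightarrow> (\<exists>n. ctx_step \<Sigma> n T S \<and> enat n = ll \<Sigma> \<rho> T)"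
    unfolding ll_step_def ctx_step_def by blast
  then show ?thesis by (auto simp: ctx_step_iff)
qed

lemma internal_step_iff:
  "(T, S) \<in> internal_step \<Sigma> \<rho> (bang_beta \<Sigma>) \<longleftrightarrow> wf_trm \<Sigma> T \<and> (\<exists>n. beta_at n T S \<and> ll \<Sigma> \<rho> T < enat n)"
proof -
  have "(T, S) \<in> internal_step \<Sigma> \<rho> (bang_beta \<Sigma>) \<longleftrightarrow> (\<exists>n. ctx_step \<Sigma> n T S \<and> ll \<Sigma> \<rho> T < enat n)"
    unfolding internal_step_def ctx_step_def by blast
  then show ?thesis by (auto simp: ctx_step_iff)
qed

lemma ll_le:
  assumes "wf_trm \<Sigma> T" and "beta_at n T S"
  shows "ll \<Sigma> \<rho> T \<le> enat n"
proof -
  from assms have "ctx_step \<Sigma> n T S" by (simp add: ctx_step_iff)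
  then obtain C R R' where C: "C \<in> ctxs \<Sigma>" "(R, R') \<in> bang_beta \<Sigma>" "lev C = n"
      "T = plug C R" by (rule ctx_stepE)
  then have "R \<in> redexes \<Sigma> \<rho>" by (auto simp: redexes_def)
  with C show ?thesis unfolding ll_def by (intro Inf_lower) blast
qed

section \<open>Sequences of steps with restricted levels\<close>

text \<open>Used with \<open>(=) d\<close> for level exactly \<open>d\<close>, and with the partial
  application \<open>(\<le>) d\<close> for level at least \<open>d\<close>.\<close>

definition beta_in :: "(nat \<Rightarrow> bool) \<Rightarrow> 'o trm \<Rightarrow> 'o trm \<Rightarrow> bool" where
  "beta_in P T S \<longleftrightarrow> (\<exists>n. P n \<and> beta_at n T S)"

lemma rtranclp_map:
  assumes "\<And>x y. r x y \<Longrightarrow> q (f x) (f y)" and "r\<^sup>*\<^sup>* x y"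
  shows "q\<^sup>*\<^sup>* (f x) (f y)"
  using assms(2) by induction (auto intro: assms(1) rtranclp.rtrancl_into_rtrancl)

lemma betas_ren: "(beta_in P)\<^sup>*\<^sup>* T S \<Longrightarrow> (beta_in P)\<^sup>*\<^sup>* (ren r T) (ren r S)"
  by (erule rtranclp_map[rotated]) (auto simp: beta_in_def intro: beta_at_ren)

lemma betas_Abs: "(beta_in P)\<^sup>*\<^sup>* T S \<Longrightarrow> (beta_in P)\<^sup>*\<^sup>* (Abs T) (Abs S)"
  by (erule rtranclp_map[rotated]) (auto simp: beta_in_def intro: beta_at.intros)

lemma betas_App:
  assumes "(beta_in P)\<^sup>*\<^sup>* T T'" and "(beta_in P)\<^sup>*\<^sup>* S S'"
  shows "(beta_in P)\<^sup>*\<^sup>* (App T S) (App T' S')"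
proof -
  have "(beta_in P)\<^sup>*\<^sup>* (App T S) (App T' S)"
    using assms(1) by (rule rtranclp_map[rotated]) (auto simp: beta_in_def intro: beta_at.intros)
  also have "(beta_in P)\<^sup>*\<^sup>* (App T' S) (App T' S')"
    using assms(2) by (rule rtranclp_map[rotated]) (auto simp: beta_in_def intro: beta_at.intros)
  finally show ?thesis .
qed

lemma betas_Bang:
  assumes "(beta_in P)\<^sup>*\<^sup>* T S" and "\<And>n. P n \<Longrightarrow> Q (Suc n)"
  shows "(beta_in Q)\<^sup>*\<^sup>* (Bang T) (Bang S)"
  using assms(1) by (rule rtranclp_map[rotated]) (auto simp: beta_in_def intro: beta_at.intros assms(2))

lemma betas_Op:
  assumes "list_all2 (beta_in P)\<^sup>*\<^sup>* Ts Ss" and Q: "\<And>n. P n \<Longrightarrow> Q (Suc n)"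
  shows "(beta_in Q)\<^sup>*\<^sup>* (Op f Ts) (Op f Ss)"
proof -
  \<comment> \<open>The prefix \<open>Us\<close> collects the arguments that are already
    reduced.\<close>
  have "(beta_in Q)\<^sup>*\<^sup>* (Op f (Us @ Ts)) (Op f (Us @ Ss))" for Us
    using assms(1)
  proof (induction arbitrary: Us rule: list_all2_induct)
    case (Cons T Ts S Ss)
    have "(beta_in Q)\<^sup>*\<^sup>* (Op f (Us @ T # Ts)) (Op f (Us @ S # Ts))"
      using Cons.hyps(1)
      by (rule rtranclp_map[rotated]) (auto simp: beta_in_def intro: beta_at.intros Q)
    also have "(beta_in Q)\<^sup>*\<^sup>* (Op f (Us @ S # Ts)) (Op f (Us @ S # Ss))"
      using Cons.IH[of "Us @ [S]"] by simp
    finally show ?case .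
  qed simp
  from this[of "[]"] show ?thesis by simp
qed

section \<open>Parallel reduction above a level\<close>

text \<open>Below level 0 nothing is restricted any more, hence the truncated \<open>d - 1\<close>.\<close>

inductive par :: "nat \<Rightarrow> 'o trm \<Rightarrow> 'o trm \<Rightarrow> bool" where
  Var: "par d (Var x) (Var x)"
| Abs: "par d T T' \<Longrightarrow> par d (Abs T) (Abs T')"
| App: "par d T T' \<Longrightarrow> par d S S' \<Longrightarrow> par d (App T S) (App T' S')"
| Bang: "par (d - 1) T T' \<Longrightarrow> par d (Bang T) (Bang T')"
| Op: "list_all2 (par (d - 1)) Ts Ts' \<Longrightarrow> par d (Op f Ts) (Op f Ts')"
| beta: "par 0 B B' \<Longrightarrow> par 0 S S' \<Longrightarrow> par 0 (App (Abs B) (Bang S)) (inst B' S')"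

lemma par_refl: "par d T T"
  by (induction T arbitrary: d) (auto intro!: par.intros simp: list.rel_refl_strong)

lemma par_mono: "par d T S \<Longrightarrow> e \<le> d \<Longrightarrow> par e T S"
proof (induction arbitrary: e rule: par.induct)
  case (Op d Ts Ts' f)
  have "list_all2 (par (e - 1)) Ts Ts'"
    using Op.IH by (rule list_all2_mono) (use Op.prems in auto)
  then show ?case by (rule par.Op)
qed (auto intro: par.intros)

lemma par_ren: "par d T S \<Longrightarrow> par d (ren r T) (ren r S)"
proof (induction arbitrary: r rule: par.induct)
  case (Op d Ts Ts' f)
  have "list_all2 (\<lambda>x y. par (d - 1) (ren r x) (ren r y)) Ts Ts'"
    using Op.IH by (rule list_all2_mono) auto
  then show ?case by (auto intro!: par.Op simp: list.rel_map)
qed (auto intro: par.intros simp: ren_inst)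

lemma par_lift_subst: "(\<And>x. par d (s x) (s' x)) \<Longrightarrow> par d (lift_subst s x) (lift_subst s' x)"
  by (auto split: nat.split intro: par.intros par_ren)

text \<open>A variable may occur in \<open>T\<close> at level 0, where the reduction of
  \<open>s x\<close> keeps its level; hence the conclusion is at level 0 whatever \<open>d\<close>
  is.\<close>

lemma par_msubst:
  assumes "par d T T'" and "\<And>x. par 0 (s x) (s' x)"
  shows "par 0 (msubst s T) (msubst s' T')"
  using assms
proof (induction arbitrary: s s' rule: par.induct)
  case (Abs d T T')
  from Abs.IH[of "lift_subst s" "lift_subst s'"] Abs.prems show ?case
    by (auto intro: par.intros par_lift_subst)
next
  case (Op d Ts Ts' f)
  have "list_all2 (\<lambda>x y. par (0 - 1) (msubst s x) (msubst s' y)) Ts Ts'"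
    using Op.IH by (rule list_all2_mono) (use Op.prems in auto)
  then show ?case by (auto intro!: par.Op simp: list.rel_map)
next
  case (beta B B' S S')
  have "par 0 (msubst (lift_subst s) B) (msubst (lift_subst s') B')"
    by (rule beta.IH) (rule par_lift_subst, rule beta.prems)
  moreover have "par 0 (msubst s S) (msubst s' S')" by (rule beta.IH) (rule beta.prems)
  ultimately show ?case by (auto intro: par.beta simp: msubst_inst)
qed (auto intro: par.intros)

lemma beta_at_par: "beta_at n T S \<Longrightarrow> par n T S"
  by (induction rule: beta_at.induct)
    (auto intro!: par.intros par_refl list_all2_appendI list.rel_refl_strong)

lemma par_betas: "par d T S \<Longrightarrow> (beta_in ((\<le>) d))\<^sup>*\<^sup>* T S"
proof (induction rule: par.induct)
  case (Bang d T T')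
  then show ?case by (auto intro: betas_Bang)
next
  case (Op d Ts Ts' f)
  have "list_all2 (beta_in ((\<le>) (d - 1)))\<^sup>*\<^sup>* Ts Ts'"
    using Op.IH by (rule list_all2_mono) auto
  then show ?case by (rule betas_Op) auto
next
  case (beta B B' S S')
  have "(beta_in ((\<le>) 0))\<^sup>*\<^sup>* (App (Abs B) (Bang S)) (App (Abs B') (Bang S'))"
    by (intro betas_App betas_Abs betas_Bang[where P = "(\<le>) 0"] beta.IH) simp
  also have "beta_in ((\<le>) 0) (App (Abs B') (Bang S')) (inst B' S')"
    by (auto simp: beta_in_def intro: beta_at.intros)
  finally show ?case .
qed (auto intro: betas_Abs betas_App)

text \<open>A contraction of level at least \<open>d\<close> leaves its contractum under at least
  \<open>d\<close> nested \<open>Bang\<close> or \<open>Op\<close> constructors of \<open>S\<close>,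
  each of which adds to the size.\<close>

lemma par_size_eq: "par d T S \<Longrightarrow> size S < d \<Longrightarrow> T = S"
proof (induction rule: par.induct)
  case (Op d Ts Ts' f)
  have "list_all2 (=) Ts Ts'"
    using Op.IH
  proof (rule list.rel_mono_strong)
    fix T T' assume "T' \<in> set Ts'"
      and "par (d - 1) T T' \<and> (size T' < d - 1 \<longrightarrow> T = T')"
    moreover from \<open>T' \<in> set Ts'\<close> have "size T' \<le> size_list size Ts'"
      by (rule size_list_estimation') simp
    ultimately show "T = T'" using Op.prems by auto
  qed
  then show ?case by (simp add: list.rel_eq)
qed auto

section \<open>Merge and split\<close>

text \<open>The rule \<open>par.beta\<close> exists only at level 0, so at a positive level the
  outermost constructor of the target is also that of the source.\<close>

inductive_cases par_AbsE: "par (Suc d) T (Abs S)"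
inductive_cases par_AppE: "par (Suc d) T (App S U)"
inductive_cases par_BangE: "par (Suc d) T (Bang S)"
inductive_cases par_OpE: "par (Suc d) T (Op f Ss)"

text \<open>The constructors on the path to the contracted redex, and those of the redex itself, lie
  at level at most \<open>e\<close>, where \<open>par (Suc e)\<close> contracts nothing. So
  \<open>T\<close> has the same redex, and \<open>par.beta\<close> contracts it along with the
  reductions inside it.\<close>

lemma par_merge: "beta_at e S U \<Longrightarrow> par (Suc e) T S \<Longrightarrow> par 0 T U"
proof (induction arbitrary: T rule: beta_at.induct)
  case (beta B S)
  then obtain B0 S0 where "T = App (Abs B0) (Bang S0)" "par 1 B0 B" "par 0 S0 S"
    by (auto elim!: par_AppE par_AbsE par_BangE)
  then show ?case by (auto intro: par.beta par_mono)
next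
  case (Op n S S' f Ss Us)
  then obtain Ts where T: "T = Op f Ts" and "list_all2 (par (Suc n)) Ts (Ss @ S # Us)"
    by (auto elim: par_OpE)
  then obtain Ts1 T1 Ts2 where Ts: "Ts = Ts1 @ T1 # Ts2" "list_all2 (par (Suc n)) Ts1 Ss"
      "par (Suc n) T1 S" "list_all2 (par (Suc n)) Ts2 Us"
    by (auto simp: list_all2_append2 list_all2_Cons2)
  have "list_all2 (par 0) Ts1 Ss" "list_all2 (par 0) Ts2 Us"
    using Ts by (auto elim!: list_all2_mono intro: par_mono)
  then have "list_all2 (par (0 - 1)) Ts (Ss @ S' # Us)"
    using Ts Op.IH by (auto intro!: list_all2_appendI)
  then show ?case unfolding T by (rule par.Op)
qed (auto elim!: par_AbsE par_AppE par_BangE intro!: par.intros intro: par_mono)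

text \<open>Substituted occurrences at level 0 perform their own level-0 steps first, by the last
  assumption. Occurrences under \<open>Bang\<close> or \<open>Op\<close> have positive level, so
  there the unsplit reduction from \<open>s x\<close> to \<open>s' x\<close> is already
  allowed.\<close>

lemma split_msubst:
  assumes "par (Suc 0) T T'" and "\<And>x. par 0 (s x) (s' x)"
    and "\<And>x. \<exists>U. (beta_in ((=) 0))\<^sup>*\<^sup>* (s x) U \<and> par (Suc 0) U (s' x)"
  shows "\<exists>U. (beta_in ((=) 0))\<^sup>*\<^sup>* (msubst s T) U \<and> par (Suc 0) U (msubst s' T')"
  using assms
proof (induction "Suc 0" T T' arbitrary: s s' rule: par.induct)
  case (Abs T T')
  have "\<exists>U. (beta_in ((=) 0))\<^sup>*\<^sup>* (lift_subst s x) U \<and> par (Suc 0) U (lift_subst s' x)" for x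
    using Abs.prems(2) by (cases x) (auto intro: par.Var dest: betas_ren par_ren, blast dest: betas_ren par_ren)
  then have "\<exists>U. (beta_in ((=) 0))\<^sup>*\<^sup>* (msubst (lift_subst s) T) U \<and>
      par (Suc 0) U (msubst (lift_subst s') T')"
    by (intro Abs.hyps) (rule par_lift_subst, rule Abs.prems)
  then show ?case by (auto intro: betas_Abs par.Abs)
next
  case (App T T' S S')
  from App.hyps(2)[of s s', OF App.prems] App.hyps(4)[of s s', OF App.prems] show ?case
    by (auto intro: betas_App par.App)
next
  case (Bang T T')
  then have "par 0 (msubst s T) (msubst s' T')"
    by (intro par_msubst[of _ T T' s s'])
  then have "par (Suc 0) (msubst s (Bang T)) (msubst s' (Bang T'))"
    by (auto intro: par.Bang)
  then show ?case by blast
next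
  case (Op Ts Ts' f)
  have "list_all2 (\<lambda>x y. par (Suc 0 - 1) (msubst s x) (msubst s' y)) Ts Ts'"
    using Op.hyps by (rule list_all2_mono) (auto intro: par_msubst Op.prems)
  then have "par (Suc 0) (msubst s (Op f Ts)) (msubst s' (Op f Ts'))"
    by (auto intro!: par.Op simp: list.rel_map)
  then show ?case by blast
qed auto

lemma par_split: "par d T S \<Longrightarrow> \<exists>U. (beta_in ((=) d))\<^sup>*\<^sup>* T U \<and> par (Suc d) U S"
proof (induction rule: par.induct)
  case (Var d x)
  then show ?case by (auto intro: par.Var)
next
  case (Abs d T T')
  then show ?case by (auto intro: betas_Abs par.Abs)
next
  case (App d T T' S S')
  then show ?case by (auto intro: betas_App par.App)
next
  case (Bang d T T')
  show ?case
  proof (cases d)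
    case 0
    \<comment> \<open>Here \<open>d - 1\<close> and \<open>Suc d - 1\<close> are both 0: all
      reductions under the \<open>Bang\<close> have positive level and no step needs to be split
      off.\<close>
    with Bang.hyps show ?thesis by (auto intro!: par.Bang)
  next
    case (Suc n)
    with Bang.IH obtain U where "(beta_in ((=) n))\<^sup>*\<^sup>* T U" "par (Suc n) U T'" by auto
    with Suc have "(beta_in ((=) d))\<^sup>*\<^sup>* (Bang T) (Bang U)" "par (Suc d) (Bang U) (Bang T')"
      by (auto intro: par.Bang betas_Bang)
    then show ?thesis by blast
  qed
next
  case (Op d Ts Ts' f)
  show ?case
  proof (cases d)
    case 0
    have "list_all2 (par (Suc d - 1)) Ts Ts'"
      using Op.IH by (rule list_all2_mono) (auto simp: 0)
    then show ?thesis by (blast intro: par.Op)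
  next
    case (Suc n)
    have "list_all2 ((beta_in ((=) n))\<^sup>*\<^sup>* OO par (Suc n)) Ts Ts'"
      using Op.IH by (rule list_all2_mono) (auto simp: Suc)
    then obtain Us where "list_all2 (beta_in ((=) n))\<^sup>*\<^sup>* Ts Us" "list_all2 (par (Suc n)) Us Ts'"
      by (auto simp: list.rel_compp)
    with Suc have "(beta_in ((=) d))\<^sup>*\<^sup>* (Op f Ts) (Op f Us)" "par (Suc d) (Op f Us) (Op f Ts')"
      by (auto intro: par.Op betas_Op)
    then show ?thesis by blast
  qed
next
  case (beta B B' S S')
  \<comment> \<open>Only the body is split before the contraction. Under its \<open>Bang\<close> the
    argument has no level-0 steps; those of \<open>S\<close> reach level 0 only once substituted
    into \<open>B0\<close>.\<close>
  then obtain B0 where B0: "(beta_in ((=) 0))\<^sup>*\<^sup>* B B0" "par (Suc 0) B0 B'" by blast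
  have "\<exists>U. (beta_in ((=) 0))\<^sup>*\<^sup>* (inst B0 S) U \<and> par (Suc 0) U (inst B' S')"
    unfolding inst_def
  proof (rule split_msubst[OF B0(2)])
    show "par 0 (case_nat S Var x) (case_nat S' Var x)" for x
      using beta.hyps(2) by (auto split: nat.split intro: par.Var)
    show "\<exists>U. (beta_in ((=) 0))\<^sup>*\<^sup>* (case_nat S Var x) U \<and> par (Suc 0) U (case_nat S' Var x)" for x
      using beta.IH(2) by (cases x) (auto simp only: nat.case intro: par.Var)
  qed
  then obtain U where U: "(beta_in ((=) 0))\<^sup>*\<^sup>* (inst B0 S) U" "par (Suc 0) U (inst B' S')"
    by blast
  have "(beta_in ((=) 0))\<^sup>*\<^sup>* (App (Abs B) (Bang S)) (App (Abs B0) (Bang S))"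
    using B0(1) by (auto intro!: betas_App betas_Abs)
  also have "beta_in ((=) 0) (App (Abs B0) (Bang S)) (inst B0 S)"
    by (auto simp: beta_in_def intro: beta_at.intros)
  also note U(1)
  finally show ?case using U(2) by blast
qed

section \<open>Factorization\<close>

locale good_ll =
  fixes \<Sigma> :: "'o sig" and \<rho> :: "'o trm rel"
  assumes good: "good_least_level \<Sigma> \<rho>"
begin

abbreviation lls :: "'o trm rel" where "lls \<equiv> ll_step \<Sigma> \<rho> (bang_beta \<Sigma>)"
abbreviation ints :: "'o trm rel" where "ints \<equiv> internal_step \<Sigma> \<rho> (bang_beta \<Sigma>)"

text \<open>The disjunct \<open>T = S\<close> matters when the least level of \<open>T\<close> is infinite.\<close>

definition par_int :: "'o trm rel" where
  "par_int = {(T, S). T = S \<or> (\<exists>d. ll \<Sigma> \<rho> T < enat d \<and> par d T S)}"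

lemma ll_mono: "wf_trm \<Sigma> T \<Longrightarrow> beta_at n T S \<Longrightarrow> ll \<Sigma> \<rho> T \<le> ll \<Sigma> \<rho> S"
  using good step_iff[of T S \<Sigma>] unfolding good_least_level_def by blast

lemma ll_internal: "wf_trm \<Sigma> T \<Longrightarrow> beta_at n T S \<Longrightarrow> ll \<Sigma> \<rho> T < enat n \<Longrightarrow> ll \<Sigma> \<rho> T = ll \<Sigma> \<rho> S"
  using good internal_step_iff[of T S \<Sigma> \<rho>] unfolding good_least_level_def by blast

text \<open>Goodness keeps the least level constant along internal steps, so it remains below
  \<open>d\<close> and every later step is internal as well.\<close>

lemma betas_internal:
  assumes "(beta_in ((\<le>) d))\<^sup>*\<^sup>* T S" "wf_trm \<Sigma> T" "ll \<Sigma> \<rho> T < enat d"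
  shows "(T, S) \<in> ints\<^sup>* \<and> wf_trm \<Sigma> S \<and> ll \<Sigma> \<rho> S = ll \<Sigma> \<rho> T"
  using assms
proof induction
  case (step S U)
  then obtain n where n: "beta_at n S U" "d \<le> n" by (auto simp: beta_in_def)
  have S: "(T, S) \<in> ints\<^sup>*" "wf_trm \<Sigma> S" "ll \<Sigma> \<rho> S = ll \<Sigma> \<rho> T" using step by auto
  have lt: "ll \<Sigma> \<rho> S < enat n" using S(3) step.prems(2) n(2) by (simp add: order.strict_trans2)
  with n S have "(S, U) \<in> ints" by (auto simp: internal_step_iff)
  with S n lt show ?case
    using ll_internal[of S n U] by (auto intro: wf_beta_at rtrancl.rtrancl_into_rtrancl)
qed simp

lemma par_int_internal: "(T, S) \<in> par_int \<Longrightarrow> wf_trm \<Sigma> T \<Longrightarrow> (T, S) \<in> ints\<^sup>* \<and> wf_trm \<Sigma> S \<and> ll \<Sigma> \<rho> S = ll \<Sigma> \<rho> T"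
  unfolding par_int_def using betas_internal par_betas by blast

text \<open>The redex about to be contracted bounds the least level by \<open>d\<close> from above,
  the invariant bounds it from below; monotonicity preserves the invariant.\<close>

lemma betas_least_level:
  assumes "(beta_in ((=) d))\<^sup>*\<^sup>* T S" "wf_trm \<Sigma> T" "enat d \<le> ll \<Sigma> \<rho> T"
  shows "(T, S) \<in> lls\<^sup>* \<and> wf_trm \<Sigma> S \<and> enat d \<le> ll \<Sigma> \<rho> S"
  using assms
proof induction
  case (step S U)
  then have S: "(T, S) \<in> lls\<^sup>*" "wf_trm \<Sigma> S" "enat d \<le> ll \<Sigma> \<rho> S" "beta_at d S U"
    by (auto simp: beta_in_def)
  then have "(S, U) \<in> lls" using ll_le[OF S(2,4), of \<rho>] by (auto simp: ll_step_iff)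
  with S show ?case
    using ll_mono[OF S(2,4)] by (auto intro: wf_beta_at rtrancl.rtrancl_into_rtrancl)
qed simp

lemma par_factor:
  assumes "par d T S" and "wf_trm \<Sigma> T" and "enat d \<le> ll \<Sigma> \<rho> T"
  shows "(T, S) \<in> lls\<^sup>* O par_int"
  using assms
\<comment> \<open>The target \<open>S\<close> is fixed while \<open>d\<close> grows. The
  \<open>Suc\<close> makes the measure decrease even from \<open>d = size S\<close>.\<close>
proof (induction "Suc (size S) - d" arbitrary: d T rule: less_induct)
  case less
  show ?case
  proof (cases "size S < d")
    case True
    then have "T = S" using less.prems(1) par_size_eq by blast
    then show ?thesis by (auto simp: par_int_def)
  next
    case False
    obtain U where "(beta_in ((=) d))\<^sup>*\<^sup>* T U" and par: "par (Suc d) U S"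
      using par_split[OF less.prems(1)] by blast
    then have U: "(T, U) \<in> lls\<^sup>*" "wf_trm \<Sigma> U" "enat d \<le> ll \<Sigma> \<rho> U"
      using betas_least_level less.prems by blast+
    show ?thesis
    \<comment> \<open>The least level of \<open>U\<close> is at least \<open>d\<close>. If it equals
      \<open>d\<close>, what remains is internal; otherwise the lower bound holds for
      \<open>Suc d\<close> and splitting continues.\<close>
    proof (cases "ll \<Sigma> \<rho> U < enat (Suc d)")
      case True
      with par have "(U, S) \<in> par_int" by (auto simp: par_int_def)
      with U show ?thesis by blast
    next
      case ge: False
      have "(U, S) \<in> lls\<^sup>* O par_int"
        by (rule less.hyps[OF _ par U(2)]) (use False ge in auto)
      with U(1) show ?thesis by (meson relcomp.cases relcomp.relcompI rtrancl_trans)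
    qed
  qed
qed

text \<open>Parallel internal reduction preserves the least level, so the step from \<open>S\<close>
  has a level \<open>n < d\<close> and can be merged. The merged reduction is then factored afresh
  from level 0, where the lower bound is trivial.\<close>

lemma postpone_step:
  assumes "wf_trm \<Sigma> T" and "(T, S) \<in> par_int" and "(S, U) \<in> lls"
  shows "(T, U) \<in> lls\<^sup>* O par_int"
proof (cases "T = S")
  case True
  with assms show ?thesis by (auto simp: par_int_def)
next
  case False
  with assms obtain d where d: "ll \<Sigma> \<rho> T < enat d" "par d T S" by (auto simp: par_int_def)
  obtain n where n: "beta_at n S U" "enat n = ll \<Sigma> \<rho> S" using assms by (auto simp: ll_step_iff)
  have "ll \<Sigma> \<rho> S = ll \<Sigma> \<rho> T" using par_int_internal assms by blast
  with n d have "Suc n \<le> d" by (metis Suc_leI enat_ord_simps(2))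
  with d have "par (Suc n) T S" by (auto intro: par_mono)
  with n have "par 0 T U" by (auto intro: par_merge)
  then show ?thesis using assms by (intro par_factor[of 0]) (auto simp: zero_enat_def[symmetric])
qed

lemma wf_lls: "(T, S) \<in> lls\<^sup>* \<Longrightarrow> wf_trm \<Sigma> T \<Longrightarrow> wf_trm \<Sigma> S"
  by (induction rule: rtrancl_induct) (auto simp: ll_step_iff intro: wf_beta_at)

lemma postpone:
  assumes "(S, U) \<in> lls\<^sup>*" and "wf_trm \<Sigma> T" and "(T, S) \<in> par_int"
  shows "(T, U) \<in> lls\<^sup>* O par_int"
  using assms
proof (induction rule: rtrancl_induct)
  case (step U V)
  then obtain W where W: "(T, W) \<in> lls\<^sup>*" "(W, U) \<in> par_int" by blast
  then have "wf_trm \<Sigma> W" using wf_lls step.prems by blast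
  with W step.hyps have "(W, V) \<in> lls\<^sup>* O par_int" by (blast intro: postpone_step)
  with W(1) show ?case by (meson relcomp.cases relcomp.relcompI rtrancl_trans)
qed blast

lemma factorization:
  assumes "(T, S) \<in> (step \<Sigma> (bang_beta \<Sigma>))\<^sup>*" and "wf_trm \<Sigma> T"
  shows "(T, S) \<in> lls\<^sup>* O ints\<^sup>*"
  using assms
proof (induction rule: converse_rtrancl_induct)
  case (step T U)
  then obtain n where n: "beta_at n T U" by (auto simp: step_iff)
  then have "wf_trm \<Sigma> U" using step.prems wf_beta_at by blast
  then obtain V where V: "(U, V) \<in> lls\<^sup>*" "(V, S) \<in> ints\<^sup>*" using step.IH by blast
  have le: "ll \<Sigma> \<rho> T \<le> enat n" using ll_le step.prems n by blast
  show ?case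
  proof (cases "ll \<Sigma> \<rho> T = enat n")
    case True
    then have "(T, U) \<in> lls" using n step.prems by (auto simp: ll_step_iff)
    with V show ?thesis by (meson converse_rtrancl_into_rtrancl relcomp.relcompI)
  next
    case False
    \<comment> \<open>A single internal step is viewed as a parallel one, with \<open>d = n\<close>,
      because least-level steps moved in front of it may duplicate its redex.\<close>
    with le n have "(T, U) \<in> par_int"
      using beta_at_par by (auto simp: par_int_def order.strict_iff_order)
    then obtain W where W: "(T, W) \<in> lls\<^sup>*" "(W, V) \<in> par_int"
      using postpone V(1) step.prems by blast
    then have "(W, V) \<in> ints\<^sup>*" using par_int_internal wf_lls step.prems by blast
    with V(2) W(1) show ?thesis by (meson relcomp.relcompI rtrancl_trans)
  qed
qed blast

end

theorem theorem2:
  fixes \<Sigma> :: "'o sig" and \<rho> :: "'o trm rel" and T S :: "'o trm"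
  assumes "is_rule \<Sigma> \<rho>"
    and "good_least_level \<Sigma> \<rho>"
    and "T \<in> terms \<Sigma>" and "S \<in> terms \<Sigma>"
    and "(T, S) \<in> (step \<Sigma> (bang_beta \<Sigma>))\<^sup>*"
  shows "(T, S) \<in> (ll_step \<Sigma> \<rho> (bang_beta \<Sigma>))\<^sup>* O (internal_step \<Sigma> \<rho> (bang_beta \<Sigma>))\<^sup>*"
proof -
  interpret good_ll \<Sigma> \<rho> by standard (rule assms(2))
  show ?thesis using factorization assms(3,5) by (simp add: terms_iff_wf)
qed

end
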